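(* Let $G$ be a finite group and let $H$ be a normal subgroup of $G$. Then the normal subgroup based power graph $\Gamma_H(G)$ is Eulerian if and only if $|G|\equiv |H| \pmod 2$.
   Context: For a finite group $G$ with identity $e$ and a normal subgroup $H$ of $G$, the normal subgroup based power graph $\Gamma_H(G)$ is the simple undirected graph with vertex set $V(\Gamma_H(G))=(G\setminus H)\cup\{e\}$, in which two distinct vertices $x,y$ are adjacent if and only if $xH=y^mH$ or $yH=x^nH$ for some $m,n\in\mathbb{N}$. Here $\mathbb{N}$ denotes the positive integers. A connected graph is Eulerian if it has a closed trail containing all of its edges, equivalently if every vertex has even degree (a one-vertex graph counts as Eulerian). *)

theory Defs
  imports
    "HOL-Algebra.Coset"
    "HOL-Number_Theory.Cong"
    "Graph_Theory.Graph_Theory"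
begin

text \<open>
  As in \<open>Graph_Theory\<close>, a simple undirected graph is a finite, symmetric, loop-free digraph without
  parallel arcs: the edge between \<open>x\<close> and \<open>y\<close> is the pair of arcs \<open>(x, y)\<close>, \<open>(y, x)\<close>.
\<close>

definition normal_subgroup_based_power_graph ::
    "('a, 'b) monoid_scheme \<Rightarrow> 'a set \<Rightarrow> 'a pair_pre_digraph" where
  "normal_subgroup_based_power_graph G H =
    (let V = (carrier G - H) \<union> {\<one>\<^bsub>G\<^esub>} in
      \<lparr> pverts = V,
        parcs = {(x, y). x \<in> V \<and> y \<in> V \<and> x \<noteq> y \<and>
          ((\<exists>m::nat. m > 0 \<and> x <#\<^bsub>G\<^esub> H = (y [^]\<^bsub>G\<^esub> m) <#\<^bsub>G\<^esub> H) \<or>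
           (\<exists>n::nat. n > 0 \<and> y <#\<^bsub>G\<^esub> H = (x [^]\<^bsub>G\<^esub> n) <#\<^bsub>G\<^esub> H))} \<rparr>)"

lemma pair_graph_normal_subgroup_based_power_graph:
  assumes "group G" "finite (carrier G)"
  shows "pair_graph (normal_subgroup_based_power_graph G H)"
proof -
  let ?V = "(carrier G - H) \<union> {\<one>\<^bsub>G\<^esub>}"
  have "finite (parcs (normal_subgroup_based_power_graph G H))"
    by (rule finite_subset[of _ "?V \<times> ?V"])
      (use assms in \<open>auto simp: normal_subgroup_based_power_graph_def Let_def\<close>)
  then show ?thesis
    using assms
    by unfold_locales
      (auto simp: normal_subgroup_based_power_graph_def Let_def symmetric_def intro!: symI)
qed

definition undirected_edge :: "'a \<times> 'a \<Rightarrow> 'a set" where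
  "undirected_edge e = {fst e, snd e}"

text \<open>
  The library's \<open>trail\<close> and \<open>euler_trail\<close> only forbid repeating an arc, so in a symmetric digraph
  they may traverse an edge once in each direction. Here edges, not arcs, must not be repeated.
  The empty walk is a closed trail, so a one-vertex graph is Eulerian.
\<close>

definition closed_undirected_trail ::
    "'a pair_pre_digraph \<Rightarrow> 'a \<Rightarrow> ('a \<times> 'a) awalk \<Rightarrow> bool" where
  "closed_undirected_trail \<Gamma> u p \<longleftrightarrow>
    pre_digraph.awalk (with_proj \<Gamma>) u p u \<and> distinct (map undirected_edge p)"

definition eulerian :: "'a pair_pre_digraph \<Rightarrow> bool" where
  "eulerian \<Gamma> \<longleftrightarrow>
    Digraph_Component.connected (with_proj \<Gamma>) \<and>
    (\<exists>u p. closed_undirected_trail \<Gamma> u p \<and>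
      undirected_edge ` set p = undirected_edge ` parcs \<Gamma>)"

end

theory Submission
  imports Defs "HOL-Algebra.Multiplicative_Group"
begin

text \<open>
  A connected simple graph is Eulerian iff all its degrees are even: a longest trail uses every edge
  at its last vertex, so parity makes it closed; if it missed an edge, some missed edge would be
  incident with one of its vertices, and rotating the trail to that vertex would allow an extension.

  In the power graph the identity is adjacent to every other vertex, so the graph is connected and
  the degree of the identity is \<open>\<bar>G\<bar> - \<bar>H\<bar>\<close>. For a vertex \<open>x \<notin> H\<close>, the identity replaces
  \<open>x\<close> itself in the count, so the degree of \<open>x\<close> is the size of
  \<open>{y \<in> G - H. xH \<in> \<langle>yH\<rangle> \<or> yH \<in> \<langle>xH\<rangle>}\<close>. This set is a union of cosets of \<open>H\<close>, so its size
  is even if \<open>\<bar>H\<bar>\<close> is; it is closed under inversion, which has no fixed point in it if \<open>\<bar>G\<bar>\<close> is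
  odd.
\<close>

section \<open>Euler's theorem for simple graphs\<close>

lemma undirected_edge_eq_iff:
  "undirected_edge e = undirected_edge f \<longleftrightarrow> e = f \<or> e = (snd f, fst f)"
  by (cases e; cases f) (auto simp: undirected_edge_def doubleton_eq_iff)

text \<open>As no edge repeats, counting list positions is the same as counting edges. This links
  the parity of visits to \<open>w\<close> with the degree of \<open>w\<close>.\<close>

lemma length_filter_incident:
  assumes "distinct (map undirected_edge p)"
  shows "length (filter (\<lambda>e. w \<in> undirected_edge e) p) = card {d \<in> undirected_edge ` set p. w \<in> d}"
proof -
  have "{d \<in> undirected_edge ` set p. w \<in> d} = set (filter ((\<in>) w) (map undirected_edge p))"
    by auto
  then show ?thesis
    using distinct_card[OF distinct_filter[OF assms, of "(\<in>) w"]]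
    by (simp add: filter_map o_def)
qed

context pair_graph
begin

text \<open>Every edge at \<open>w\<close> has exactly one orientation that leaves \<open>w\<close>,
  and symmetry makes that orientation an arc.\<close>

lemma card_incident_edges:
  "card {d \<in> undirected_edge ` parcs G. w \<in> d} = out_degree G w"
proof -
  have "bij_betw undirected_edge (out_arcs G w) {d \<in> undirected_edge ` parcs G. w \<in> d}"
    unfolding bij_betw_def
  proof (intro conjI equalityI subsetI)
    show "inj_on undirected_edge (out_arcs G w)"
      by (auto simp: inj_on_def undirected_edge_eq_iff)
  next
    fix d assume "d \<in> {d \<in> undirected_edge ` parcs G. w \<in> d}"
    then obtain x y where "(x, y) \<in> parcs G" "d = {x, y}" "w = x \<or> w = y"
      by (auto simp: undirected_edge_def)
    moreover from this have "(y, x) \<in> parcs G"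
      using arcs_symmetric by blast
    ultimately show "d \<in> undirected_edge ` out_arcs G w"
      by (force simp: undirected_edge_def)
  next
    fix d assume "d \<in> undirected_edge ` out_arcs G w"
    then show "d \<in> {d \<in> undirected_edge ` parcs G. w \<in> d}"
      by (auto simp: undirected_edge_def[of "(w, _)"])
  qed
  then show ?thesis
    by (simp add: out_degree_def bij_betw_same_card)
qed

text \<open>Each arc flips the parity at its two ends, which are distinct because there are no
  loops. Along a walk these flips cancel except at its two extremities.\<close>

lemma even_incident_iff:
  assumes "awalk u p v"
  shows "even (length (filter (\<lambda>e. w \<in> undirected_edge e) p)) \<longleftrightarrow> (w = u \<longleftrightarrow> w = v)"
  using assms
proof (induction p arbitrary: u)
  case Nil
  then show ?case by (simp add: awalk_Nil_iff)
next
  case (Cons e p)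
  then have "fst e \<noteq> snd e" "u = fst e" "awalk (snd e) p v"
    using pair_no_loops by (auto simp: awalk_Cons_iff)
  with Cons.IH[of "snd e"] show ?case
    by (auto simp: undirected_edge_def)
qed

section \<open>Longest trails and their extension\<close>

lemma longest_undirected_trail:
  assumes "pverts G \<noteq> {}"
  obtains u p v where "awalk u p v" "distinct (map undirected_edge p)"
    "\<And>u' p' v'. awalk u' p' v' \<Longrightarrow> distinct (map undirected_edge p') \<Longrightarrow> length p' \<le> length p"
proof -
  define P where "P p \<longleftrightarrow> (\<exists>u v. awalk u p v) \<and> distinct (map undirected_edge p)" for p
  have nil: "P []"
    using assms by (auto simp: P_def awalk_Nil_iff)
  \<comment> \<open>Distinct edges force distinct arcs, so the number of arcs bounds the length of
    any trail.\<close>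
  have bound: "\<forall>p. P p \<longrightarrow> length p < Suc (card (parcs G))"
  proof (intro allI impI)
    fix p assume "P p"
    have "distinct p" "set p \<subseteq> parcs G"
      using \<open>P p\<close> by (auto simp: P_def distinct_map)
    then show "length p < Suc (card (parcs G))"
      using card_mono[OF pair_finite_arcs] distinct_card by (metis le_imp_less_Suc)
  qed
  obtain p where "P p" "\<And>q. P q \<Longrightarrow> length q \<le> length p"
    using ex_has_greatest_nat[OF nil bound] by auto
  then show thesis
    using that unfolding P_def by blast
qed

text \<open>Supplies the place where a closed trail that misses an edge can be opened and
  prolonged.\<close>

lemma connected_unused_edge:
  assumes "connected G" "awalk u p v" "undirected_edge ` set p \<noteq> undirected_edge ` parcs G"
  obtains x y where "(x, y) \<in> parcs G" "x \<in> set (pawalk_verts u p)"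
    "undirected_edge (x, y) \<notin> undirected_edge ` set p"
proof -
  have rev: "set (rev_path p) = {(y, x). (x, y) \<in> set p}"
    by (induction p) auto
  \<comment> \<open>Walking back along \<open>p\<close> makes the arcs used closed under reversal, so that the directed
    statement applies.\<close>
  have walk: "awalk u (p @ rev_path p) u"
    using assms(2) by (intro awalk_appendI) auto
  have verts: "set (pawalk_verts u (p @ rev_path p)) = set (pawalk_verts u p)"
  proof -
    have "fst ` set (rev_path p) = snd ` set p" "snd ` set (rev_path p) = fst ` set p"
      unfolding rev by force+
    then show ?thesis
      unfolding set_awalk_verts[OF assms(2)] set_awalk_verts[OF walk]
      by (simp add: image_Un) blast
  qed
  have "set (p @ rev_path p) \<noteq> parcs G"
  proof
    assume eq: "set (p @ rev_path p) = parcs G"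
    have "undirected_edge ` set (rev_path p) \<subseteq> undirected_edge ` set p"
      unfolding rev by (force simp: undirected_edge_def)
    with eq assms(3) show False
      by (metis image_Un set_append sup.absorb1)
  qed
  then obtain e where e: "e \<in> parcs G" "e \<notin> set (p @ rev_path p)"
    "fst e \<in> set (pawalk_verts u p) \<or> snd e \<in> set (pawalk_verts u p)"
    using awalk_connected[OF assms(1) walk] verts by blast
  obtain a b where ab: "e = (a, b)" by fastforce
  have unused: "undirected_edge (a, b) \<notin> undirected_edge ` set p"
    using e(2) unfolding ab by (auto simp: undirected_edge_eq_iff rev)
  moreover have "undirected_edge (b, a) = undirected_edge (a, b)"
    by (auto simp: undirected_edge_def)
  moreover have "(b, a) \<in> parcs G"
    using e(1) ab arcs_symmetric by blast
  ultimately show thesis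
    using e that[of a b] that[of b a] unfolding ab by auto
qed

lemma eulerian_if_even_degrees:
  assumes conn: "connected G" and even: "\<And>v. v \<in> pverts G \<Longrightarrow> even (out_degree G v)"
  shows "eulerian G"
proof -
  have "pverts G \<noteq> {}"
    using conn by (auto simp: connected_def strongly_connected_def)
  then obtain u p v where p: "awalk u p v" "distinct (map undirected_edge p)"
    and longest: "\<And>u' p' v'. awalk u' p' v' \<Longrightarrow> distinct (map undirected_edge p') \<Longrightarrow>
      length p' \<le> length p"
    using longest_undirected_trail by blast
  \<comment> \<open>Otherwise appending the arc would give a longer trail. The claim is stated for
    any trail as long as \<open>p\<close> because it is applied both to \<open>p\<close> and to a
    rotation of \<open>p\<close>.\<close>
  have used: "undirected_edge (x, y) \<in> undirected_edge ` set q"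
    if q: "awalk w q x" "distinct (map undirected_edge q)" "length q = length p"
      and xy: "(x, y) \<in> parcs G" for w q x y
  proof (rule ccontr)
    assume "undirected_edge (x, y) \<notin> undirected_edge ` set q"
    moreover have "awalk x [(x, y)] y"
      using xy by (auto simp: awalk_simps dest: in_arcsD2)
    with q(1) have "awalk w (q @ [(x, y)]) y"
      by (rule awalk_appendI)
    ultimately show False
      using longest[of w "q @ [(x, y)]" y] q by simp
  qed
  \<comment> \<open>By maximality \<open>p\<close> uses every edge at its last vertex
    \<open>v\<close>, so \<open>p\<close> meets \<open>v\<close> exactly
    \<open>out_degree G v\<close> times.\<close>
  have "{d \<in> undirected_edge ` set p. v \<in> d} = {d \<in> undirected_edge ` parcs G. v \<in> d}"
  proof (intro equalityI subsetI)
    fix d assume "d \<in> {d \<in> undirected_edge ` parcs G. v \<in> d}"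
    then obtain x y where xy: "(x, y) \<in> parcs G" "d = {x, y}" "v = x \<or> v = y"
      by (auto simp: undirected_edge_def)
    moreover from this have "(y, x) \<in> parcs G"
      using arcs_symmetric by blast
    ultimately have "d \<in> undirected_edge ` set p"
      using used[OF p refl, of x] used[OF p refl, of y]
      by (metis fst_conv insert_commute snd_conv undirected_edge_def)
    with xy show "d \<in> {d \<in> undirected_edge ` set p. v \<in> d}"
      by auto
  qed (use p(1) in auto)
  then have "even (length (filter (\<lambda>e. v \<in> undirected_edge e) p))"
    using even[OF awalk_last_in_verts[OF p(1)]]
    by (simp add: length_filter_incident[OF p(2)] card_incident_edges)
  then have closed: "u = v"
    using even_incident_iff[OF p(1)] by auto
  have "undirected_edge ` set p = undirected_edge ` parcs G"
  proof (rule ccontr)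
    assume "undirected_edge ` set p \<noteq> undirected_edge ` parcs G"
    then obtain x y where xy: "(x, y) \<in> parcs G" "x \<in> set (pawalk_verts u p)"
      "undirected_edge (x, y) \<notin> undirected_edge ` set p"
      using connected_unused_edge[OF conn p(1)] by blast
    obtain q r where qr: "p = q @ r" "awalk u q x" "awalk x r v"
      using awalk_decomp[OF p(1) xy(2)] by blast
    \<comment> \<open>Since \<open>p\<close> is closed, it can be rotated to begin and end at
      \<open>x\<close>. Length and edges are unchanged, so \<open>used\<close> applies at
      \<open>x\<close>.\<close>
    have "awalk x (r @ q) x"
      using qr(3) qr(2)[unfolded closed] by (rule awalk_appendI)
    then have "undirected_edge (x, y) \<in> undirected_edge ` set (r @ q)"
      using p(2) xy(1) qr(1) by (intro used) auto
    with qr(1) xy(3) show False by auto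
  qed
  with conn p closed show ?thesis
    unfolding eulerian_def closed_undirected_trail_def by blast
qed

lemma even_degree_if_eulerian:
  assumes "eulerian G"
  shows "even (out_degree G v)"
proof -
  obtain u p where p: "awalk u p u" "distinct (map undirected_edge p)"
    "undirected_edge ` set p = undirected_edge ` parcs G"
    using assms unfolding eulerian_def closed_undirected_trail_def by blast
  have "even (length (filter (\<lambda>e. v \<in> undirected_edge e) p))"
    using even_incident_iff[OF p(1)] by blast
  then show ?thesis
    by (simp add: length_filter_incident[OF p(2)] p(3) card_incident_edges)
qed

lemma connected_if_universal_vertex:
  assumes "c \<in> pverts G" "\<And>v. v \<in> pverts G \<Longrightarrow> v \<noteq> c \<Longrightarrow> (v, c) \<in> parcs G"
  shows "connected G"
proof (rule connectedI)
  fix u v assume uv: "u \<in> pverts G" "v \<in> pverts G"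
  have "w \<rightarrow>\<^sup>*\<^bsub>with_proj G\<^esub> c \<and> c \<rightarrow>\<^sup>*\<^bsub>with_proj G\<^esub> w" if "w \<in> pverts G" for w
  proof (cases "w = c")
    case True
    then show ?thesis using that by auto
  next
    case False
    then have "(w, c) \<in> parcs G" "(c, w) \<in> parcs G"
      using assms(2)[OF that] arcs_symmetric by blast+
    then show ?thesis by auto
  qed
  then have "u \<rightarrow>\<^sup>*\<^bsub>with_proj G\<^esub> v"
    using uv by (auto intro: reachable_trans)
  then show "u \<rightarrow>\<^sup>*\<^bsub>mk_symmetric G\<^esub> v"
    by (rule reachable_mk_symmetricI)
qed (use assms(1) in auto)

end

section \<open>Degrees in the power graph\<close>

text \<open>The orbits \<open>{x, f x}\<close> partition \<open>S\<close> into blocks of size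
  two.\<close>

lemma even_card_if_involution:
  assumes "finite S" and "\<And>x. x \<in> S \<Longrightarrow> f x \<in> S \<and> f (f x) = x \<and> f x \<noteq> x"
  shows "even (card S)"
proof -
  have "\<Union> ((\<lambda>x. {x, f x}) ` S) = S"
    using assms(2) by auto
  moreover have "2 dvd card (\<Union> ((\<lambda>x. {x, f x}) ` S))"
  proof (rule dvd_partition)
    show "\<forall>c\<in>(\<lambda>x. {x, f x}) ` S. 2 dvd card c"
      using assms(2) by (metis (no_types, lifting) card_2_iff dvd_refl imageE)
    show "\<forall>c1\<in>(\<lambda>x. {x, f x}) ` S. \<forall>c2\<in>(\<lambda>x. {x, f x}) ` S. c1 \<noteq> c2 \<longrightarrow> c1 \<inter> c2 = {}"
    proof (intro ballI impI)
      fix c1 c2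
      assume "c1 \<in> (\<lambda>x. {x, f x}) ` S" "c2 \<in> (\<lambda>x. {x, f x}) ` S" and neq: "c1 \<noteq> c2"
      then obtain x y where xy: "x \<in> S" "y \<in> S" and c: "c1 = {x, f x}" "c2 = {y, f y}"
        by blast
      have "x \<noteq> y" "x \<noteq> f y" "f x \<noteq> y"
        using neq assms(2)[OF xy(1)] assms(2)[OF xy(2)] unfolding c by auto
      moreover from this have "f x \<noteq> f y"
        using assms(2)[OF xy(1)] assms(2)[OF xy(2)] by metis
      ultimately show "c1 \<inter> c2 = {}"
        unfolding c by auto
    qed
  qed (use assms in auto)
  ultimately show ?thesis by simp
qed

section \<open>Inverses and positive powers in finite groups\<close>

context group
begin

lemma inv_eq_pos_pow:
  assumes "finite (carrier G)" "a \<in> carrier G"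
  obtains k :: nat where "k > 0" "inv a = a [^] k"
proof
  have "order G > 0"
    using assms(1) order_gt_0_iff_finite by simp
  \<comment> \<open>The exponent \<open>2 * order G - 1\<close> is positive even in the trivial
    group, where \<open>order G - 1\<close> would be zero.\<close>
  then have "Suc (2 * order G - 1) = order G * 2" by simp
  then have "a [^] (2 * order G - 1) \<otimes> a = a [^] (order G * 2)"
    by (metis nat_pow_Suc)
  also have "\<dots> = \<one>"
    using assms(2) pow_order_eq_1[OF assms(2)] by (simp flip: nat_pow_pow)
  finally show "inv a = a [^] (2 * order G - 1)"
    using assms(2) by (simp add: inv_equality)
  show "2 * order G - 1 > 0"
    using \<open>order G > 0\<close> by simp
qed

text \<open>If \<open>a\<close> is its own inverse then its square is \<open>\<one>\<close>, so
  raising \<open>a\<close> to the odd exponent \<open>order G\<close> gives back \<open>a\<close>;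
  but that power is \<open>\<one>\<close>.\<close>

lemma inv_neq_self:
  assumes "odd (order G)" "a \<in> carrier G" "a \<noteq> \<one>"
  shows "inv a \<noteq> a"
proof
  assume "inv a = a"
  with assms(2) have sq: "a [^] (2::nat) = \<one>"
    by (metis nat_pow_Suc nat_pow_0 numeral_2_eq_2 r_inv l_one)
  obtain k where "order G = Suc (2 * k)"
    using assms(1) by (auto elim: oddE)
  then have "a [^] order G = (a [^] (2::nat)) [^] k \<otimes> a"
    using assms(2) by (simp add: nat_pow_pow)
  with sq assms(2,3) pow_order_eq_1[OF assms(2)] show False
    by simp
qed

text \<open>To be instantiated with the quotient \<open>G Mod H\<close>, where it becomes the
  adjacency condition on cosets. It is reflexive, unlike adjacency.\<close>

definition power_related :: "'a \<Rightarrow> 'a \<Rightarrow> bool" where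
  "power_related a b \<longleftrightarrow> (\<exists>m::nat. m > 0 \<and> a = b [^] m) \<or> (\<exists>n::nat. n > 0 \<and> b = a [^] n)"

text \<open>Exponent one suffices.\<close>

lemma power_related_refl: "a \<in> carrier G \<Longrightarrow> power_related a a"
  unfolding power_related_def by (metis nat_pow_eone zero_less_one)

lemma power_related_inv:
  assumes "finite (carrier G)" "a \<in> carrier G" "b \<in> carrier G" "power_related a b"
  shows "power_related a (inv b)"
proof -
  obtain k :: nat where k: "k > 0" "inv b = b [^] k"
    using inv_eq_pos_pow assms by blast
  obtain l :: nat where l: "l > 0" "b = (inv b) [^] l"
    using inv_eq_pos_pow[of "inv b"] assms by auto
  show ?thesis
    using assms(4) unfolding power_related_def
  proof (elim disjE exE conjE)
    fix m :: nat assume "m > 0" "a = b [^] m"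
    then have "a = (inv b) [^] (l * m)"
      using l(2) assms(3) by (metis inv_closed nat_pow_pow)
    moreover have "l * m > 0"
      using \<open>m > 0\<close> l(1) by simp
    ultimately show "(\<exists>m::nat. m > 0 \<and> a = inv b [^] m) \<or> (\<exists>n::nat. n > 0 \<and> inv b = a [^] n)"
      by blast
  next
    fix n :: nat assume "n > 0" "b = a [^] n"
    then have "inv b = a [^] (n * k)"
      using k(2) assms(2) by (metis nat_pow_pow)
    moreover have "n * k > 0"
      using \<open>n > 0\<close> k(1) by simp
    ultimately show "(\<exists>m::nat. m > 0 \<and> a = inv b [^] m) \<or> (\<exists>n::nat. n > 0 \<and> inv b = a [^] n)"
      by blast
  qed
qed

end

context normal
begin

lemma power_graph_arc_iff:
  "(x, y) \<in> parcs (normal_subgroup_based_power_graph G H) \<longleftrightarrow>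
    x \<in> (carrier G - H) \<union> {\<one>} \<and> y \<in> (carrier G - H) \<union> {\<one>} \<and> x \<noteq> y \<and>
    group.power_related (G Mod H) (H #> x) (H #> y)"
proof -
  interpret Q: group "G Mod H" by (rule factorgroup_is_group)
  have pow: "H #> a [^] n = (H #> a) [^]\<^bsub>G Mod H\<^esub> n"
    if "a \<in> carrier G" for a and n :: nat
    using hom_nat_pow[OF r_coset_hom_Mod that is_group Q.is_group] .
  have coset: "l_coset G a H = H #> a" if "a \<in> carrier G" for a
    using that coset_eq by simp
  show ?thesis
  proof (cases "x \<in> carrier G \<and> y \<in> carrier G")
    case True
    then show ?thesis
      by (simp add: normal_subgroup_based_power_graph_def Let_def Q.power_related_def pow coset)
  next
    case False
    then show ?thesis
      by (auto simp: normal_subgroup_based_power_graph_def Let_def)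
  qed
qed

lemma power_related_one:
  assumes "finite (carrier G)" "x \<in> carrier G"
  shows "group.power_related (G Mod H) (H #> x) (H #> \<one>)"
proof -
  interpret Q: group "G Mod H" by (rule factorgroup_is_group)
  have "H #> \<one> = (H #> x) [^]\<^bsub>G Mod H\<^esub> order G"
    using hom_nat_pow[OF r_coset_hom_Mod assms(2) is_group Q.is_group] pow_order_eq_1[OF assms(2)]
    by metis
  then show ?thesis
    unfolding Q.power_related_def using assms(1) order_gt_0_iff_finite by blast
qed

lemma power_graph_out_degree_one:
  assumes "finite (carrier G)"
  shows "out_degree (normal_subgroup_based_power_graph G H) \<one> = order G - card H"
proof -
  let ?\<Gamma> = "normal_subgroup_based_power_graph G H"
  interpret \<Gamma>: pair_graph ?\<Gamma>
    using is_group assms by (rule pair_graph_normal_subgroup_based_power_graph)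
  have "(\<one>, y) \<in> parcs ?\<Gamma>" if "y \<in> carrier G - H" for y
    using that power_related_one[OF assms, of y] \<Gamma>.arcs_symmetric[of y \<one>] one_closed
    by (auto simp: power_graph_arc_iff)
  then have "out_arcs ?\<Gamma> \<one> = Pair \<one> ` (carrier G - H)"
    by (auto simp: power_graph_arc_iff)
  then have "out_degree ?\<Gamma> \<one> = card (carrier G - H)"
    by (simp add: out_degree_def card_image inj_on_def)
  also have "\<dots> = order G - card H"
    using assms subset by (simp add: card_Diff_subset finite_subset order_def)
  finally show ?thesis .
qed

lemma power_graph_out_degree:
  assumes "finite (carrier G)" "x \<in> carrier G - H"
  shows "out_degree (normal_subgroup_based_power_graph G H) x =
    card {y \<in> carrier G - H. group.power_related (G Mod H) (H #> x) (H #> y)}" (is "_ = card ?S")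
proof -
  let ?\<Gamma> = "normal_subgroup_based_power_graph G H"
  interpret Q: group "G Mod H" by (rule factorgroup_is_group)
  have "H #> x \<in> carrier (G Mod H)"
    using assms(2) by (auto simp: FactGroup_def RCOSETS_def)
  then have x: "x \<in> ?S"
    using assms(2) Q.power_related_refl by simp
  have "out_arcs ?\<Gamma> x = Pair x ` insert \<one> (?S - {x})"
    using assms one_closed power_related_one[of x] by (auto simp: power_graph_arc_iff)
  then have "out_degree ?\<Gamma> x = card (insert \<one> (?S - {x}))"
    by (simp add: out_degree_def card_image inj_on_def del: image_insert)
  also have "\<dots> = Suc (card (?S - {x}))"
    using assms(1) one_closed by simp
  also have "\<dots> = card ?S"
    using assms(1) by (intro card_Suc_Diff1 x) simp
  finally show ?thesis .
qed

lemma even_card_related: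
  assumes "finite (carrier G)" "odd (order G) \<or> even (card H)" "x \<in> carrier G"
  shows "even (card {y \<in> carrier G - H. group.power_related (G Mod H) (H #> x) (H #> y)})"
    (is "even (card ?S)")
  using assms(2)
proof
  assume odd: "odd (order G)"
  interpret Q: group "G Mod H" by (rule factorgroup_is_group)
  have fin: "finite (carrier (G Mod H))"
    using assms(1) by (simp add: FactGroup_def RCOSETS_def)
  have mem: "H #> y \<in> carrier (G Mod H)" if "y \<in> carrier G" for y
    using that by (auto simp: FactGroup_def RCOSETS_def)
  show ?thesis
  proof (rule even_card_if_involution[where f = "m_inv G"])
    fix y assume y: "y \<in> ?S"
    then have "H #> inv y = inv\<^bsub>G Mod H\<^esub> (H #> y)"
      using mem by (simp add: inv_FactGroup rcos_inv)
    then have "Q.power_related (H #> x) (H #> inv y)"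
      using y mem assms(3) by (simp add: Q.power_related_inv[OF fin])
    moreover have "inv y \<notin> H"
      using y m_inv_closed[of "inv y"] by auto
    moreover have "inv y \<noteq> y"
      using y one_closed by (intro inv_neq_self[OF odd]) auto
    ultimately show "inv y \<in> ?S \<and> inv (inv y) = y \<and> inv y \<noteq> y"
      using y by auto
  qed (use assms(1) in auto)
next
  assume "even (card H)"
  have H: "subgroup H G" by (rule subgroup_axioms)
  have cover: "\<Union> ((#>) H ` ?S) = ?S"
  proof (intro equalityI subsetI)
    fix z assume "z \<in> \<Union> ((#>) H ` ?S)"
    then obtain y where y: "y \<in> ?S" "z \<in> H #> y" by auto
    then have z: "z \<in> carrier G" "H #> z = H #> y"
      using r_coset_subset_G[OF subset, of y] repr_independence[OF y(2) _ H] by auto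
    have "z \<notin> H"
      using z y(1) rcos_self[of y, OF _ H] rcos_const[OF is_group] by auto
    with z y(1) show "z \<in> ?S" by simp
  qed (use rcos_self[OF _ H] in auto)
  have "2 dvd card (\<Union> ((#>) H ` ?S))"
  proof (rule dvd_partition)
    show "finite (\<Union> ((#>) H ` ?S))"
      unfolding cover using assms(1) by simp
    have coset: "c \<in> rcosets H" if "c \<in> (#>) H ` ?S" for c
      using that by (auto simp: RCOSETS_def)
    show "\<forall>c\<in>(#>) H ` ?S. 2 dvd card c"
      using coset card_rcosets_equal[OF _ subset] \<open>even (card H)\<close> by metis
    show "\<forall>c1\<in>(#>) H ` ?S. \<forall>c2\<in>(#>) H ` ?S. c1 \<noteq> c2 \<longrightarrow> c1 \<inter> c2 = {}"
      using rcos_disjoint[OF H] coset by (meson disjnt_def pairwiseD)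
  qed
  with cover show ?thesis by simp
qed

end

theorem theorem4p2:
  fixes G :: "('a, 'b) monoid_scheme" and H :: "'a set"
  assumes "group G"
    and "finite (carrier G)"
    and "H \<lhd> G"
  shows "eulerian (normal_subgroup_based_power_graph G H) \<longleftrightarrow> [order G = card H] (mod 2)"
proof -
  let ?\<Gamma> = "normal_subgroup_based_power_graph G H"
  interpret normal H G by (rule assms(3))
  interpret \<Gamma>: pair_graph ?\<Gamma>
    using assms by (intro pair_graph_normal_subgroup_based_power_graph)
  have "card H \<le> order G"
    unfolding order_def using assms(2) subset by (rule card_mono)
  then have parity: "[order G = card H] (mod 2) \<longleftrightarrow> even (order G - card H)"
    by (auto simp: cong_def mod2_eq_if)
  have verts: "pverts ?\<Gamma> = (carrier G - H) \<union> {\<one>\<^bsub>G\<^esub>}"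
    by (simp add: normal_subgroup_based_power_graph_def Let_def)
  show ?thesis
  proof
    assume "eulerian ?\<Gamma>"
    then show "[order G = card H] (mod 2)"
      using \<Gamma>.even_degree_if_eulerian power_graph_out_degree_one[OF assms(2)] parity by metis
  next
    assume cong: "[order G = card H] (mod 2)"
    then have HG: "odd (order G) \<or> even (card H)"
      by (auto simp: cong_def mod2_eq_if split: if_splits)
    show "eulerian ?\<Gamma>"
    proof (rule \<Gamma>.eulerian_if_even_degrees)
      show "Digraph_Component.connected ?\<Gamma>"
      proof (rule \<Gamma>.connected_if_universal_vertex)
        fix v assume "v \<in> pverts ?\<Gamma>" "v \<noteq> \<one>\<^bsub>G\<^esub>"
        then show "(v, \<one>\<^bsub>G\<^esub>) \<in> parcs ?\<Gamma>"
          using power_related_one[OF assms(2)] by (auto simp: verts power_graph_arc_iff)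
      qed (simp add: verts)
    next
      fix v assume "v \<in> pverts ?\<Gamma>"
      then consider "v = \<one>\<^bsub>G\<^esub>" | "v \<in> carrier G - H"
        by (auto simp: verts)
      then show "even (out_degree ?\<Gamma> v)"
      proof cases
        case 1
        then show ?thesis
          using cong parity power_graph_out_degree_one[OF assms(2)] by simp
      next
        case 2
        then show ?thesis
          using power_graph_out_degree[OF assms(2) 2] even_card_related[OF assms(2) HG, of v] by auto
      qed
    qed
  qed
qed

end
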